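(* Let $n\ge 2$, $1<q<\infty$ and $\nu>-1$. Then $B_q^{0,\nu}(\mathbb{S}^{n-1})\subset L(\log^+L)^{1+\nu}(\mathbb{S}^{n-1})$; that is, every $\Omega\in B_q^{0,\nu}(\mathbb{S}^{n-1})$ satisfies $\int_{\mathbb{S}^{n-1}}|\Omega|\,(\log^+|\Omega|)^{1+\nu}\,d\sigma<\infty$.
   Context: $\mathbb{S}^{n-1}$ is the unit sphere of $\mathbb{R}^n$ and $\sigma$ is the induced Lebesgue (surface) measure; $|M|=\sigma(M)$. Functions are complex-valued and identified when equal a.e. $\log^+t=\max\{\log t,0\}$ for $t>0$, $\log^+0=0$. A cap is a set $\{x\in\mathbb{S}^{n-1}:|x-x_0|<\rho\}$ with $x_0\in\mathbb{S}^{n-1}$, $\rho>0$ (an arc when $n=2$). For $1<q<\infty$ let $1/q+1/q'=1$. A $q$-block is a measurable function $a$ on $\mathbb{S}^{n-1}$ supported in some cap $M$ with $\|a\|_{q}\le |M|^{-1/q'}$. The block space $B_q^{0,\nu}(\mathbb{S}^{n-1})$ is the set of all $\Omega\in L^1(\mathbb{S}^{n-1})$ that can be written as $\Omega=\sum_{j=1}^\infty\mu_ja_j$ (convergence in $L^1$), where $\mu_j\in\mathbb{C}$, each $a_j$ is a $q$-block supported in a cap $M_j$, and $$\sum_{j=1}^\infty|\mu_j|\Big\{1+\Big(\log^+\frac1{|M_j|}\Big)^{1+\nu}\Big\}<\infty.$$ For $\beta>0$, $L(\log^+L)^\beta(\mathbb{S}^{n-1})$ is the set of measurable $f$ with $f\in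 L^1(\mathbb{S}^{n-1})$ and $\int_{\mathbb{S}^{n-1}}|f|(\log^+|f|)^\beta d\sigma<\infty$ (equivalently $\int|f|(\log(e+|f|))^\beta d\sigma<\infty$). *)

theory Defs
  imports "HOL-Analysis.Analysis"
begin

(* Surface measure on the unit sphere by polar coordinates: for a Borel subset A of the sphere,
   sigma(A) = n * lambda {r x | 0 < r < 1, x in A}; see the lemma emeasure_sphere_measure.
   The completion gives the Lebesgue measurable subsets of the sphere. *)
definition sphere_measure :: "'a::euclidean_space measure" where
  "sphere_measure = completion (scale_measure (of_nat DIM('a))
     (distr (restrict_space lborel (ball 0 1 - {0})) (restrict_space borel (sphere 0 1))
        (\<lambda>x. x /\<^sub>R norm x)))"

lemma space_sphere_measure: "space (sphere_measure :: 'a::euclidean_space measure) = sphere 0 1"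
  by (simp add: sphere_measure_def space_scale_measure space_restrict_space)

lemma measurable_radial_projection:
  "(\<lambda>x::'a::euclidean_space. x /\<^sub>R norm x)
     \<in> restrict_space lborel (ball 0 1 - {0}) \<rightarrow>\<^sub>M restrict_space borel (sphere 0 1)"
  by (intro measurable_restrict_space2 measurable_restrict_space1)
     (auto simp: space_restrict_space)

lemma emeasure_sphere_measure:
  fixes A :: "'a::euclidean_space set"
  assumes "A \<in> sets borel" "A \<subseteq> sphere 0 1"
  shows "emeasure sphere_measure A =
    of_nat DIM('a) * emeasure lborel {r *\<^sub>R x |r x. 0 < r \<and> r < 1 \<and> x \<in> A}"
proof -
  let ?D = "distr (restrict_space lborel (ball 0 1 - {0})) (restrict_space borel (sphere 0 1))
        (\<lambda>x::'a. x /\<^sub>R norm x)"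
  have A: "A \<in> sets (restrict_space borel (sphere 0 1))"
    using assms by (auto simp: sets_restrict_space)
  have eq: "(\<lambda>x. x /\<^sub>R norm x) -` A \<inter> (ball 0 1 - {0})
      = {r *\<^sub>R x |r x. 0 < r \<and> r < 1 \<and> x \<in> A}"
  proof (intro equalityI subsetI)
    fix y assume "y \<in> (\<lambda>x. x /\<^sub>R norm x) -` A \<inter> (ball 0 1 - {0})"
    then have "y = norm y *\<^sub>R (y /\<^sub>R norm y) \<and> 0 < norm y \<and> norm y < 1 \<and> y /\<^sub>R norm y \<in> A"
      by simp
    then show "y \<in> {r *\<^sub>R x |r x. 0 < r \<and> r < 1 \<and> x \<in> A}" by blast
  next
    fix y assume "y \<in> {r *\<^sub>R x |r x. 0 < r \<and> r < 1 \<and> x \<in> A}"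
    then obtain r x where "y = r *\<^sub>R x" "0 < r" "r < 1" "x \<in> A" by blast
    moreover from this have "norm x = 1" using assms(2) by auto
    ultimately show "y \<in> (\<lambda>x. x /\<^sub>R norm x) -` A \<inter> (ball 0 1 - {0})" by auto
  qed
  have "emeasure sphere_measure A = emeasure (scale_measure (of_nat DIM('a)) ?D) A"
    unfolding sphere_measure_def using A by (simp del: emeasure_scale_measure)
  also have "\<dots> = of_nat DIM('a) * emeasure ?D A"
    by simp
  also have "emeasure ?D A = emeasure lborel ((\<lambda>x. x /\<^sub>R norm x) -` A \<inter> (ball 0 1 - {0}))"
    using A by (simp add: emeasure_distr measurable_radial_projection space_restrict_space
        emeasure_restrict_space)
  finally show ?thesis
    by (simp add: eq)
qed

definition log_plus :: "real \<Rightarrow> real" where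
  "log_plus t = (if t > 0 then max (ln t) 0 else 0)"

definition is_cap :: "'a::euclidean_space set \<Rightarrow> bool" where
  "is_cap M \<longleftrightarrow> (\<exists>x0 \<in> sphere 0 1. \<exists>\<rho>>0. M = {x \<in> sphere 0 1. norm (x - x0) < \<rho>})"

definition conjugate_exponent :: "real \<Rightarrow> real" where
  "conjugate_exponent q = q / (q - 1)"

lemma conjugate_exponent:
  assumes "1 < q"
  shows "1 / q + 1 / conjugate_exponent q = 1"
  using assms by (simp add: conjugate_exponent_def field_simps)

definition Lq_sphere :: "real \<Rightarrow> ('a::euclidean_space \<Rightarrow> complex) set" where
  "Lq_sphere q = {f \<in> borel_measurable sphere_measure.
     integrable sphere_measure (\<lambda>x. norm (f x) powr q)}"

(* Meaningful only on Lq_sphere q, since the Bochner integral of a non-integrable function is 0. *)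
definition Lq_norm :: "real \<Rightarrow> ('a::euclidean_space \<Rightarrow> complex) \<Rightarrow> real" where
  "Lq_norm q f = (\<integral>x. norm (f x) powr q \<partial>sphere_measure) powr (1 / q)"

(* Functions are identified up to null sets, so the support condition is imposed a.e. *)
definition q_block :: "real \<Rightarrow> 'a::euclidean_space set \<Rightarrow> ('a \<Rightarrow> complex) \<Rightarrow> bool" where
  "q_block q M a \<longleftrightarrow> is_cap M \<and> a \<in> Lq_sphere q \<and>
     (AE x in sphere_measure. x \<notin> M \<longrightarrow> a x = 0) \<and>
     Lq_norm q a \<le> measure sphere_measure M powr (- 1 / conjugate_exponent q)"

definition block_space :: "real \<Rightarrow> real \<Rightarrow> ('a::euclidean_space \<Rightarrow> complex) set" where
  "block_space q \<nu> = {\<Omega>. integrable sphere_measure \<Omega> \<and>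
     (\<exists>(\<mu> :: nat \<Rightarrow> complex) a M.
        (\<forall>j. q_block q (M j) (a j)) \<and>
        (\<lambda>N. \<integral>\<^sup>+ x. ennreal (norm (\<Omega> x - (\<Sum>j<N. \<mu> j * a j x))) \<partial>sphere_measure) \<longlonglongrightarrow> 0 \<and>
        summable (\<lambda>j. norm (\<mu> j) *
          (1 + log_plus (1 / measure sphere_measure (M j)) powr (1 + \<nu>))))}"

definition L_log_L :: "real \<Rightarrow> ('a::euclidean_space \<Rightarrow> complex) set" where
  "L_log_L \<beta> = {f. integrable sphere_measure f \<and>
     (\<integral>\<^sup>+ x. ennreal (norm (f x) * log_plus (norm (f x)) powr \<beta>) \<partial>sphere_measure) < \<infinity>}"

end

(* Put L t = (log^+ t)^\<beta> with \<beta> = 1 + \<nu>.  Since |\<Omega>| \<le> \<Sum>j |\<mu>_j| |a_j| almost everywhere,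
   |\<Omega>| L |\<Omega>| \<le> \<Sum>j |\<mu>_j| |a_j| L |\<Omega>|.  Where |a_j| \<ge> |\<Omega>|^(1/2) one has L |\<Omega>| \<le> 2^\<beta> L |a_j|, and the
   remaining terms are at most |\<mu>_j| |\<Omega>|^(1/2) L |\<Omega>| \<le> C |\<mu>_j| |\<Omega>|, which is summable and integrable.
   Thus it suffices that a q-block satisfies \<integral> |a| L |a| \<le> C (1 + L (1/|M|)), which follows from
   L |a| \<le> 2^\<beta> (L (|a| |M|) + L (1/|M|)) and L t \<le> C t^(q - 1). *)
theory Submission
  imports Defs
begin

section \<open>Pointwise inequalities for \<open>log_plus\<close>\<close>

lemma log_plus_nonneg: "0 \<le> log_plus t"
  by (simp add: log_plus_def)

lemma log_plus_mono: "s \<le> t \<Longrightarrow> log_plus s \<le> log_plus t"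
  by (auto simp: log_plus_def max_def)

lemma borel_measurable_log_plus [measurable]: "log_plus \<in> borel_measurable borel"
  unfolding log_plus_def[abs_def] by measurable

lemma log_plus_mult_le:
  assumes "0 < s" "0 < t"
  shows "log_plus (s * t) \<le> log_plus s + log_plus t"
  using assms by (simp add: log_plus_def ln_mult)

text \<open>Apply ln s \<le> s - 1 to s = t^(\<delta>/\<beta>), then raise to the power \<beta>. The
  exponent \<delta> stays free because q - 1 serves for blocks and 1/2 for the comparison of
  \<open>\<Omega>\<close> with a block.\<close>

lemma log_plus_powr_le:
  assumes "0 < \<beta>" "0 < \<delta>" "0 \<le> t"
  shows "log_plus t powr \<beta> \<le> (\<beta> / \<delta>) powr \<beta> * t powr \<delta>"
proof -
  have "log_plus t \<le> \<beta> / \<delta> * t powr (\<delta> / \<beta>)"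
  proof (cases "t = 0")
    case False
    then have "0 < t" using assms by simp
    have "\<delta> / \<beta> * ln t \<le> t powr (\<delta> / \<beta>)"
      using ln_le_minus_one[of "t powr (\<delta> / \<beta>)"] \<open>0 < t\<close> by (simp add: ln_powr)
    then have "ln t \<le> \<beta> / \<delta> * t powr (\<delta> / \<beta>)"
      using assms by (simp add: field_simps)
    then show ?thesis using \<open>0 < t\<close> assms by (simp add: log_plus_def)
  qed (simp add: log_plus_def)
  then have "log_plus t powr \<beta> \<le> (\<beta> / \<delta> * t powr (\<delta> / \<beta>)) powr \<beta>"
    using assms by (intro powr_mono2) (auto simp: log_plus_nonneg)
  also have "\<dots> = (\<beta> / \<delta>) powr \<beta> * t powr \<delta>"
    using assms by (subst powr_mult) (auto simp: powr_powr)
  finally show ?thesis .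
qed

text \<open>A sum is at most twice the maximum. This treats exponents below and above 1
  alike.\<close>

lemma add_powr_le:
  fixes x y :: real
  assumes "0 \<le> x" "0 \<le> y" "0 \<le> \<beta>"
  shows "(x + y) powr \<beta> \<le> 2 powr \<beta> * (x powr \<beta> + y powr \<beta>)"
proof -
  have "(x + y) powr \<beta> \<le> (2 * max x y) powr \<beta>"
    using assms by (intro powr_mono2) auto
  also have "\<dots> = 2 powr \<beta> * max x y powr \<beta>"
    using assms by (simp add: powr_mult)
  also have "\<dots> \<le> 2 powr \<beta> * (x powr \<beta> + y powr \<beta>)"
    by (intro mult_left_mono) (auto simp: max_def)
  finally show ?thesis .
qed

text \<open>Split log u into log (u m) and log (1/m), where m stands for the measure of the support.
  The right-hand side is built to be integrated: for a block, m^(q-1) u^q has integral at most 1,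
  and so has 1/m over the support.\<close>

lemma mult_log_plus_le:
  assumes "0 < \<beta>" "1 < q" "0 < m" "0 \<le> u"
  shows "u * log_plus u powr \<beta> \<le> 2 powr \<beta> *
    (((\<beta> / (q - 1)) powr \<beta> + log_plus (1 / m) powr \<beta>) * (m powr (q - 1) * u powr q)
      + log_plus (1 / m) powr \<beta> / m)"
proof (cases "u = 0")
  case True
  then show ?thesis using assms by simp
next
  case False
  then have u: "0 < u" using assms by simp
  define l where "l = log_plus (1 / m) powr \<beta>"
  define K where "K = (\<beta> / (q - 1)) powr \<beta>"
  define w where "w = m powr (q - 1) * u powr q"
  have l0: "0 \<le> l" and K0: "0 \<le> K" and w0: "0 \<le> w"
    by (simp_all add: l_def K_def w_def)
  have w_eq: "u * (u * m) powr (q - 1) = w"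
    using u assms by (simp add: w_def powr_mult powr_diff)
  \<comment> \<open>The split at u m = 1 takes the place of Hoelder's inequality: it bounds the bare
    factor u in \<open>u * l\<close> by the two quantities whose integrals are controlled.\<close>
  have "u \<le> 1 / m + w"
  proof (cases "u * m \<le> 1")
    case True
    then show ?thesis using assms w0 by (simp add: field_simps add_increasing2)
  next
    case False
    then have "1 \<le> (u * m) powr (q - 1)"
      using assms by (intro ge_one_powr_ge_zero) auto
    then have "u * 1 \<le> w"
      unfolding w_eq[symmetric] using u by (intro mult_left_mono) auto
    moreover have "0 \<le> 1 / m" using assms by simp
    ultimately show ?thesis by linarith
  qed
  then have u_l: "u * l \<le> (1 / m + w) * l"
    using l0 by (rule mult_right_mono)
  have "log_plus u \<le> log_plus (u * m) + log_plus (1 / m)"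
    using log_plus_mult_le[of "u * m" "1 / m"] u assms by simp
  then have "log_plus u powr \<beta> \<le> (log_plus (u * m) + log_plus (1 / m)) powr \<beta>"
    using assms by (intro powr_mono2) (auto simp: log_plus_nonneg)
  also have "\<dots> \<le> 2 powr \<beta> * (log_plus (u * m) powr \<beta> + l)"
    unfolding l_def using assms by (intro add_powr_le) (auto simp: log_plus_nonneg)
  also have "\<dots> \<le> 2 powr \<beta> * (K * (u * m) powr (q - 1) + l)"
    unfolding K_def using u assms
    by (intro mult_left_mono add_right_mono log_plus_powr_le) auto
  finally have "u * log_plus u powr \<beta> \<le> u * (2 powr \<beta> * (K * (u * m) powr (q - 1) + l))"
    using u by (intro mult_left_mono) auto
  also have "\<dots> = 2 powr \<beta> * (K * w + u * l)"
    unfolding w_eq[symmetric] by (simp add: algebra_simps)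
  also have "\<dots> \<le> 2 powr \<beta> * (K * w + (1 / m + w) * l)"
    using u_l by (intro mult_left_mono) auto
  also have "\<dots> = 2 powr \<beta> * ((K + l) * w + l / m)"
    by (simp add: algebra_simps)
  finally show ?thesis unfolding K_def l_def w_def .
qed

section \<open>Integral estimates on a general measure space\<close>

text \<open>Integrates \<open>mult_log_plus_le\<close> with u = |a| and m the measure of M. The
  constant depends on \<beta> and q only, so the estimate is uniform over all blocks.\<close>

lemma nn_integral_mult_log_plus_le:
  fixes a :: "'a \<Rightarrow> complex"
  assumes "0 < \<beta>" "1 < q"
    and a [measurable]: "a \<in> borel_measurable N" and M [measurable]: "M \<in> sets N"
    and int: "integrable N (\<lambda>x. norm (a x) powr q)"
    and supp: "AE x in N. x \<notin> M \<longrightarrow> a x = 0"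
    and bound: "(\<integral>x. norm (a x) powr q \<partial>N) \<le> measure N M powr (1 - q)"
  shows "(\<integral>\<^sup>+x. ennreal (norm (a x) * log_plus (norm (a x)) powr \<beta>) \<partial>N)
    \<le> ennreal (2 powr \<beta> * ((\<beta> / (q - 1)) powr \<beta> + 2) * (1 + log_plus (1 / measure N M) powr \<beta>))"
proof (cases "measure N M = 0")
  case True
  \<comment> \<open>Since \<open>0 powr (1 - q)\<close> is 0, the bound forces a to vanish almost
    everywhere. This case includes sets of infinite measure, for which \<open>measure\<close> also
    returns 0.\<close>
  have "(\<integral>x. norm (a x) powr q \<partial>N) = 0"
    using bound True by (intro antisym) (auto intro: integral_nonneg_AE)
  then have "AE x in N. norm (a x) powr q = 0"
    using integral_nonneg_eq_0_iff_AE[OF int] by simp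
  then have "(\<integral>\<^sup>+x. ennreal (norm (a x) * log_plus (norm (a x)) powr \<beta>) \<partial>N) = (\<integral>\<^sup>+x. 0 \<partial>N)"
    by (intro nn_integral_cong_AE) (auto elim!: eventually_mono)
  then show ?thesis by simp
next
  case False
  define m where "m = measure N M"
  define l where "l = log_plus (1 / m) powr \<beta>"
  define K where "K = (\<beta> / (q - 1)) powr \<beta>"
  have m: "0 < m" using False by (simp add: m_def zero_less_measure_iff)
  have emeasure_M: "emeasure N M = ennreal m"
    using False unfolding m_def by (metis emeasure_eq_ennreal_measure measure_def enn2real_top)
  have l0: "0 \<le> l" and K0: "0 \<le> K" by (simp_all add: l_def K_def)
  \<comment> \<open>The constant term has to be cut off to M, where 1/m integrates to 1. Off M the
    left side vanishes almost everywhere.\<close>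
  have "(\<integral>\<^sup>+x. ennreal (norm (a x) * log_plus (norm (a x)) powr \<beta>) \<partial>N)
      \<le> (\<integral>\<^sup>+x. ennreal (2 powr \<beta> * (K + l) * m powr (q - 1)) * ennreal (norm (a x) powr q)
            + ennreal (2 powr \<beta> * (l / m)) * indicator M x \<partial>N)"
  proof (intro nn_integral_mono_AE)
    show "AE x in N. ennreal (norm (a x) * log_plus (norm (a x)) powr \<beta>)
      \<le> ennreal (2 powr \<beta> * (K + l) * m powr (q - 1)) * ennreal (norm (a x) powr q)
            + ennreal (2 powr \<beta> * (l / m)) * indicator M x"
      using supp
    proof eventually_elim
      case (elim x)
      show ?case
      proof (cases "x \<in> M")
        case True
        have "norm (a x) * log_plus (norm (a x)) powr \<beta> \<le>
          2 powr \<beta> * (K + l) * m powr (q - 1) * norm (a x) powr q + 2 powr \<beta> * (l / m)"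
          using mult_log_plus_le[OF assms(1,2) m, of "norm (a x)"]
          by (simp add: K_def l_def algebra_simps)
        then show ?thesis
          using True K0 l0 m
          by (simp flip: ennreal_mult ennreal_plus)
      qed (use elim in simp)
    qed
  qed
  also have "\<dots> = ennreal (2 powr \<beta> * (K + l) * m powr (q - 1)) * (\<integral>\<^sup>+x. ennreal (norm (a x) powr q) \<partial>N)
            + ennreal (2 powr \<beta> * (l / m)) * emeasure N M"
    by (simp add: nn_integral_add nn_integral_cmult)
  also have "(\<integral>\<^sup>+x. ennreal (norm (a x) powr q) \<partial>N) = ennreal (\<integral>x. norm (a x) powr q \<partial>N)"
    using int by (intro nn_integral_eq_integral) auto
  also have "ennreal (2 powr \<beta> * (K + l) * m powr (q - 1)) * ennreal (\<integral>x. norm (a x) powr q \<partial>N)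
            + ennreal (2 powr \<beta> * (l / m)) * emeasure N M
     = ennreal (2 powr \<beta> * (K + l) * m powr (q - 1) * (\<integral>x. norm (a x) powr q \<partial>N)
            + 2 powr \<beta> * (l / m) * m)"
    unfolding emeasure_M using K0 l0 m
    by (simp flip: ennreal_mult ennreal_plus)
  also have "\<dots> \<le> ennreal (2 powr \<beta> * (K + l) * m powr (q - 1) * m powr (1 - q)
            + 2 powr \<beta> * (l / m) * m)"
    using bound K0 l0 unfolding m_def
    by (intro ennreal_leI add_right_mono mult_left_mono) auto
  \<comment> \<open>The powers of m cancel: \<open>K + l\<close> remains from the q-th power term
    and another \<open>l\<close> from the indicator term.\<close>
  also have "2 powr \<beta> * (K + l) * m powr (q - 1) * m powr (1 - q) + 2 powr \<beta> * (l / m) * m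
      = 2 powr \<beta> * (K + 2 * l)"
    using m by (simp add: mult.assoc flip: powr_add) (simp add: algebra_simps)
  also have "\<dots> \<le> 2 powr \<beta> * ((K + 2) * (1 + l))"
    using K0 l0 by (intro mult_left_mono) (auto simp: algebra_simps)
  finally show ?thesis
    by (simp add: K_def l_def m_def mult.assoc ennreal_leI)
qed

text \<open>By the triangle inequality, the excess of |f| over the series of |g j| is at most |f -
  S| for every partial sum S. Its integral is therefore bounded by a sequence tending to 0.\<close>

lemma norm_le_suminf_of_L1_limit:
  fixes f :: "'a \<Rightarrow> complex" and g :: "nat \<Rightarrow> 'a \<Rightarrow> complex"
  assumes [measurable]: "f \<in> borel_measurable N" "\<And>j. g j \<in> borel_measurable N"
    and lim: "(\<lambda>n. \<integral>\<^sup>+x. ennreal (norm (f x - (\<Sum>j<n. g j x))) \<partial>N) \<longlonglongrightarrow> 0"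
  shows "AE x in N. ennreal (norm (f x)) \<le> (\<Sum>j. ennreal (norm (g j x)))"
proof -
  \<comment> \<open>Subtraction in \<open>ennreal\<close> truncates at 0, so h = 0 is the claimed
    inequality, also where the series is infinite.\<close>
  define h where "h x = ennreal (norm (f x)) - (\<Sum>j. ennreal (norm (g j x)))" for x
  have [measurable]: "h \<in> borel_measurable N" unfolding h_def by measurable
  have "(\<integral>\<^sup>+x. h x \<partial>N) \<le> (\<integral>\<^sup>+x. ennreal (norm (f x - (\<Sum>j<n. g j x))) \<partial>N)" for n
  proof (intro nn_integral_mono)
    fix x
    have "norm (f x) \<le> norm (f x - (\<Sum>j<n. g j x)) + (\<Sum>j<n. norm (g j x))"
      using norm_triangle_sub[of "f x" "\<Sum>j<n. g j x"] norm_sum[of "\<lambda>j. g j x" "{..<n}"]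
      by linarith
    then have "ennreal (norm (f x)) \<le> ennreal (norm (f x - (\<Sum>j<n. g j x)) + (\<Sum>j<n. norm (g j x)))"
      by (rule ennreal_leI)
    also have "\<dots> = ennreal (norm (f x - (\<Sum>j<n. g j x))) + (\<Sum>j<n. ennreal (norm (g j x)))"
      by (simp add: sum_nonneg)
    also have "\<dots> \<le> ennreal (norm (f x - (\<Sum>j<n. g j x))) + (\<Sum>j. ennreal (norm (g j x)))"
      by (intro add_left_mono sum_le_suminf) auto
    finally show "h x \<le> ennreal (norm (f x - (\<Sum>j<n. g j x)))"
      unfolding h_def by (simp add: ennreal_minus_le_iff add.commute)
  qed
  then have "(\<integral>\<^sup>+x. h x \<partial>N) \<le> 0"
    by (intro LIMSEQ_le_const[OF lim]) auto
  then have "AE x in N. h x = 0"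
    by (simp add: nn_integral_0_iff_AE)
  then show ?thesis
    by eventually_elim (auto simp: h_def ennreal_minus_eq_0)
qed

section \<open>Caps and blocks on the sphere\<close>

lemma is_cap_sets:
  assumes "is_cap (M :: 'a::euclidean_space set)"
  shows "M \<in> sets sphere_measure"
proof -
  obtain x0 :: 'a and \<rho> where "M = {x \<in> sphere 0 1. norm (x - x0) < \<rho>}"
    using assms unfolding is_cap_def by blast
  then have "M = ball x0 \<rho> \<inter> sphere 0 1"
    by (auto simp: dist_norm norm_minus_commute)
  then have "M \<in> sets (restrict_space borel (sphere 0 1))"
    by (auto simp: sets_restrict_space)
  then show ?thesis
    unfolding sphere_measure_def by (intro sets_completionI_sets) simp
qed

text \<open>The norm condition raised to the power q, with -q/q' = 1 - q; this is the form that
  \<open>nn_integral_mult_log_plus_le\<close> takes.\<close>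

lemma q_block_integral_powr_le:
  assumes "q_block q M a" "1 < q"
  shows "(\<integral>x. norm (a x) powr q \<partial>sphere_measure) \<le> measure sphere_measure M powr (1 - q)"
proof -
  let ?I = "\<integral>x. norm (a x) powr q \<partial>sphere_measure"
  let ?m = "measure sphere_measure M"
  have "0 \<le> ?I" by (intro integral_nonneg_AE) auto
  have "?I powr (1 / q) \<le> ?m powr (- 1 / conjugate_exponent q)"
    using assms(1) by (simp add: q_block_def Lq_norm_def)
  then have "(?I powr (1 / q)) powr q \<le> (?m powr (- 1 / conjugate_exponent q)) powr q"
    using assms(2) by (intro powr_mono2) auto
  moreover have "- 1 / conjugate_exponent q * q = 1 - q"
    using assms(2) by (simp add: conjugate_exponent_def field_simps)
  ultimately show ?thesis
    using assms(2) \<open>0 \<le> ?I\<close> by (simp add: powr_powr)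
qed

section \<open>Comparison of logarithms and the inclusion\<close>

text \<open>Used with u = |a j| and t = |\<open>\<Omega>\<close>|. Above the threshold sqrt t, ln t
  = 2 ln (sqrt t) \<le> 2 ln u for t > 0. Below it, u gives one factor sqrt t and the bound on the
  logarithm the other, so the error is linear in t.\<close>

lemma mult_log_plus_compare:
  assumes "0 < \<beta>" "0 \<le> t" "0 \<le> u"
  shows "u * log_plus t powr \<beta>
    \<le> 2 powr \<beta> * (u * log_plus u powr \<beta>) + (\<beta> / (1 / 2)) powr \<beta> * t"
proof (cases "sqrt t \<le> u")
  case True
  have "log_plus t \<le> 2 * log_plus (sqrt t)"
    using assms by (auto simp: log_plus_def ln_sqrt)
  also have "\<dots> \<le> 2 * log_plus u"
    using True by (simp add: log_plus_mono)
  finally have "log_plus t powr \<beta> \<le> (2 * log_plus u) powr \<beta>"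
    using assms by (intro powr_mono2) (auto simp: log_plus_nonneg)
  then have "u * log_plus t powr \<beta> \<le> u * (2 powr \<beta> * log_plus u powr \<beta>)"
    using assms by (intro mult_left_mono) (auto simp: powr_mult log_plus_nonneg)
  moreover have "0 \<le> (\<beta> / (1 / 2)) powr \<beta> * t" using assms by simp
  ultimately show ?thesis by (simp add: algebra_simps)
next
  case False
  have "u * log_plus t powr \<beta> \<le> sqrt t * ((\<beta> / (1 / 2)) powr \<beta> * t powr (1 / 2))"
    using False assms by (intro mult_mono log_plus_powr_le) auto
  also have "\<dots> = (\<beta> / (1 / 2)) powr \<beta> * t"
    using assms by (simp add: powr_half_sqrt)
  finally show ?thesis using assms by (simp add: add_increasing)
qed

theorem theoremB:
  fixes q \<nu> :: real
  assumes "2 \<le> CARD('n::finite)" and "1 < q" and "\<nu> > -1"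
  shows "(block_space q \<nu> :: (real ^ 'n \<Rightarrow> complex) set) \<subseteq> L_log_L (1 + \<nu>)"
proof
  fix \<Omega> :: "real ^ 'n \<Rightarrow> complex"
  assume "\<Omega> \<in> block_space q \<nu>"
  then obtain \<mu> :: "nat \<Rightarrow> complex" and a M where
    int: "integrable sphere_measure \<Omega>" and block: "\<And>j. q_block q (M j) (a j)" and
    lim: "(\<lambda>N. \<integral>\<^sup>+ x. ennreal (norm (\<Omega> x - (\<Sum>j<N. \<mu> j * a j x))) \<partial>sphere_measure) \<longlonglongrightarrow> 0" and
    summ: "summable (\<lambda>j. norm (\<mu> j) *
          (1 + log_plus (1 / measure sphere_measure (M j)) powr (1 + \<nu>)))"
    unfolding block_space_def by blast
  define \<beta> where "\<beta> = 1 + \<nu>"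
  have \<beta>: "0 < \<beta>" using assms by (simp add: \<beta>_def)
  define L where "L t = log_plus t powr \<beta>" for t
  define l where "l j = L (1 / measure sphere_measure (M j))" for j
  define C where "C = 2 powr \<beta> * ((\<beta> / (q - 1)) powr \<beta> + 2)"
  define D where "D = (\<beta> / (1 / 2)) powr \<beta>"
  have C0: "0 \<le> C" and D0: "0 \<le> D" and L0: "0 \<le> L t" and l0: "0 \<le> l j" for t j
    by (simp_all add: C_def D_def L_def l_def)
  have [measurable]: "L \<in> borel_measurable borel" unfolding L_def by measurable
  have [measurable]: "\<Omega> \<in> borel_measurable sphere_measure" using int by simp
  have a_meas [measurable]: "a j \<in> borel_measurable sphere_measure" for j
    using block[of j] by (simp add: q_block_def Lq_sphere_def)
  have summ_l: "summable (\<lambda>j. norm (\<mu> j) * (1 + l j))"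
    using summ by (simp add: l_def L_def \<beta>_def)
  \<comment> \<open>The summand 1 in the weight makes the coefficients summable. This controls the
    error terms, whose integral \<open>D * ?I\<close> is the same for every j.\<close>
  have summ_\<mu>: "summable (\<lambda>j. norm (\<mu> j))"
    by (rule summable_comparison_test'[OF summ_l]) (auto simp: l0 algebra_simps)
  have block_le: "(\<integral>\<^sup>+x. ennreal (norm (a j x) * L (norm (a j x))) \<partial>sphere_measure)
      \<le> ennreal (C * (1 + l j))" for j
    unfolding L_def l_def C_def
    by (intro nn_integral_mult_log_plus_le \<beta> assms a_meas q_block_integral_powr_le block is_cap_sets)
      (use block[of j] in \<open>auto simp: q_block_def Lq_sphere_def\<close>)
  have "AE x in sphere_measure. ennreal (norm (\<Omega> x)) \<le> (\<Sum>j. ennreal (norm (\<mu> j * a j x)))"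
    by (rule norm_le_suminf_of_L1_limit[OF _ _ lim]) measurable
  then have "AE x in sphere_measure. ennreal (norm (\<Omega> x) * L (norm (\<Omega> x)))
      \<le> (\<Sum>j. ennreal (norm (\<mu> j)) * (ennreal (2 powr \<beta>) * ennreal (norm (a j x) * L (norm (a j x)))
            + ennreal D * ennreal (norm (\<Omega> x))))"
  proof eventually_elim
    case (elim x)
    have "ennreal (norm (\<Omega> x) * L (norm (\<Omega> x)))
        \<le> (\<Sum>j. ennreal (norm (\<mu> j * a j x))) * ennreal (L (norm (\<Omega> x)))"
      using elim by (simp add: ennreal_mult L0 mult_right_mono)
    also have "\<dots> = (\<Sum>j. ennreal (norm (\<mu> j * a j x)) * ennreal (L (norm (\<Omega> x))))"
      by (rule ennreal_suminf_multc[symmetric])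
    also have "\<dots> \<le> (\<Sum>j. ennreal (norm (\<mu> j)) *
        (ennreal (2 powr \<beta>) * ennreal (norm (a j x) * L (norm (a j x)))
            + ennreal D * ennreal (norm (\<Omega> x))))"
    proof (intro suminf_le summableI)
      fix j
      have "norm (a j x) * L (norm (\<Omega> x))
          \<le> 2 powr \<beta> * (norm (a j x) * L (norm (a j x))) + D * norm (\<Omega> x)"
        unfolding L_def D_def by (intro mult_log_plus_compare \<beta>) auto
      then have "norm (\<mu> j) * (norm (a j x) * L (norm (\<Omega> x)))
          \<le> norm (\<mu> j) * (2 powr \<beta> * (norm (a j x) * L (norm (a j x))) + D * norm (\<Omega> x))"
        by (rule mult_left_mono) simp
      then show "ennreal (norm (\<mu> j * a j x)) * ennreal (L (norm (\<Omega> x)))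
          \<le> ennreal (norm (\<mu> j)) * (ennreal (2 powr \<beta>) * ennreal (norm (a j x) * L (norm (a j x)))
            + ennreal D * ennreal (norm (\<Omega> x)))"
        using L0 D0 by (simp add: norm_mult mult.assoc flip: ennreal_mult ennreal_plus)
    qed
    finally show ?case .
  qed
  then have "(\<integral>\<^sup>+x. ennreal (norm (\<Omega> x) * L (norm (\<Omega> x))) \<partial>sphere_measure)
      \<le> (\<integral>\<^sup>+x. (\<Sum>j. ennreal (norm (\<mu> j)) *
            (ennreal (2 powr \<beta>) * ennreal (norm (a j x) * L (norm (a j x)))
            + ennreal D * ennreal (norm (\<Omega> x)))) \<partial>sphere_measure)"
    by (rule nn_integral_mono_AE)
  \<comment> \<open>All terms are nonnegative, so sum and integral may be exchanged before
    finiteness is known.\<close>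
  also have "\<dots> = (\<Sum>j. ennreal (norm (\<mu> j)) *
        (ennreal (2 powr \<beta>) * (\<integral>\<^sup>+x. ennreal (norm (a j x) * L (norm (a j x))) \<partial>sphere_measure)
          + ennreal D * (\<integral>\<^sup>+x. ennreal (norm (\<Omega> x)) \<partial>sphere_measure)))"
    by (simp add: nn_integral_suminf nn_integral_add nn_integral_cmult)
  also have "(\<integral>\<^sup>+x. ennreal (norm (\<Omega> x)) \<partial>sphere_measure)
      = ennreal (\<integral>x. norm (\<Omega> x) \<partial>sphere_measure)" (is "_ = ennreal ?I")
    using int by (intro nn_integral_eq_integral) auto
  also have "(\<Sum>j. ennreal (norm (\<mu> j)) *
        (ennreal (2 powr \<beta>) * (\<integral>\<^sup>+x. ennreal (norm (a j x) * L (norm (a j x))) \<partial>sphere_measure)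
          + ennreal D * ennreal ?I))
     \<le> (\<Sum>j. ennreal (norm (\<mu> j)) * (ennreal (2 powr \<beta>) * ennreal (C * (1 + l j)) + ennreal D * ennreal ?I))"
    by (intro suminf_le summableI mult_left_mono add_right_mono block_le) auto
  also have "\<dots> = (\<Sum>j. ennreal (2 powr \<beta> * C * (norm (\<mu> j) * (1 + l j)) + D * ?I * norm (\<mu> j)))"
    using C0 D0 l0 by (simp add: algebra_simps flip: ennreal_mult ennreal_plus)
  also have "\<dots> < \<infinity>"
  proof -
    \<comment> \<open>The first part converges by the condition defining the block space, the second
      by the summability of the coefficients.\<close>
    have "summable (\<lambda>j. 2 powr \<beta> * C * (norm (\<mu> j) * (1 + l j)) + D * ?I * norm (\<mu> j))"
      by (intro summable_add summable_mult summ_l summ_\<mu>)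
    moreover have "0 \<le> 2 powr \<beta> * C * (norm (\<mu> j) * (1 + l j)) + D * ?I * norm (\<mu> j)" for j
      using C0 D0 l0 by (intro add_nonneg_nonneg mult_nonneg_nonneg) auto
    ultimately show ?thesis
      by (simp add: suminf_ennreal2)
  qed
  finally show "\<Omega> \<in> L_log_L (1 + \<nu>)"
    using int by (simp add: L_log_L_def L_def \<beta>_def)
qed

end
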